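(* Let $a,b,c>0$ be real numbers with $\max\{a,b\}<c<a+b$, let $p\in\mathbb{R}$, and let $\mathcal{F}_p(x)=(1-x)^pF(a,b;c;x)$ for $x\in(0,1)$. Put $$p_*=\frac12+\frac{ab}{c}-\sqrt{\frac14+\frac{ab(c-a)(c-b)}{c^2(c+1)}},\qquad p^*=\frac12+\frac{ab}{c}+\sqrt{\frac14+\frac{ab(c-a)(c-b)}{c^2(c+1)}}.$$ Then: (i) $-\mathcal{F}_p'$ is absolutely monotonic on $(0,1)$ if and only if $\frac{ab}{c}\le p\le a+b+1-c$; (ii) $-\mathcal{F}_p''$ is absolutely monotonic on $(0,1)$ if and only if $p_*\le p\le a+b+1-c$; (iii) if $p^*\le p\le a+b+2-c$, then $\mathcal{F}_p''$ is absolutely monotonic on $(0,1)$.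
   Context: $F(a,b;c;x)=\sum_{n=0}^\infty\frac{(a)_n(b)_n}{(c)_n}\frac{x^n}{n!}$ is the Gaussian hypergeometric function, with $(a)_0=1$ and $(a)_n=a(a+1)\cdots(a+n-1)$ for $n\ge1$. A function $f$ is absolutely monotonic on an interval $I$ if all derivatives $f^{(k)}$ exist on $I$ and $f^{(k)}(x)\ge0$ for all $x\in I$ and all integers $k\ge0$. *)

theory Defs
  imports "HOL-Analysis.Analysis"
begin

definition hypergeo_2F1 :: "real \<Rightarrow> real \<Rightarrow> real \<Rightarrow> real \<Rightarrow> real" where
  "hypergeo_2F1 a b c x =
     (\<Sum>n. pochhammer a n * pochhammer b n / pochhammer c n * (x ^ n / fact n))"

lemma hypergeo_2F1_eq_eval_fps:
  "hypergeo_2F1 a b c x = eval_fps (fps_hypergeo [a, b] [c] 1) x"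
  by (simp add: hypergeo_2F1_def eval_fps_def)

text \<open>
  The derivatives are two-sided, so this is the usual notion of absolute monotonicity only
  for open \<open>I\<close>.
\<close>
definition absolutely_monotonic_on :: "(real \<Rightarrow> real) \<Rightarrow> real set \<Rightarrow> bool" where
  "absolutely_monotonic_on f I \<longleftrightarrow>
     (\<forall>k. \<forall>x\<in>I. (deriv ^^ k) f differentiable (at x) \<and> (deriv ^^ k) f x \<ge> 0)"

text \<open>Only the values for \<open>0 < x < 1\<close> are meaningful.\<close>
definition weighted_2F1 :: "real \<Rightarrow> real \<Rightarrow> real \<Rightarrow> real \<Rightarrow> real \<Rightarrow> real" where
  "weighted_2F1 a b c p x = (1 - x) powr p * hypergeo_2F1 a b c x"

definition p_lower :: "real \<Rightarrow> real \<Rightarrow> real \<Rightarrow> real" where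
  "p_lower a b c =
     1/2 + a * b / c - sqrt (1/4 + a * b * (c - a) * (c - b) / (c\<^sup>2 * (c + 1)))"

definition p_upper :: "real \<Rightarrow> real \<Rightarrow> real \<Rightarrow> real" where
  "p_upper a b c =
     1/2 + a * b / c + sqrt (1/4 + a * b * (c - a) * (c - b) / (c\<^sup>2 * (c + 1)))"

end

theory Submission
  imports Defs
begin

text \<open>
  Write \<open>h = a + b - c > 0\<close> and \<open>q = p - h\<close>. Euler's transformation
  \<open>F(a,b;c;x) = (1 - x)\<^bsup>-h\<^esup> V(x)\<close>, with \<open>V = F(c-a,c-b;c;\<cdot>)\<close>, turns the weighted function into
  \<open>P = (1 - x)\<^bsup>q\<^esup> V\<close>. The transformation holds because its right-hand side solves Gauss's
  equation (\<open>euler_transformation\<close>). The gain is that \<open>V\<close> has positive coefficients with a finite sum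
  (\<open>summable_gauss_fps\<close>), and that the bound \<open>p \<le> a + b + 1 - c\<close> becomes \<open>q \<le> 1\<close>.

  Absolute monotonicity on \<open>(0, 1)\<close> of a function given by a power series means that all its
  coefficients are nonnegative (\<open>absolutely_monotonic_on_iff_fps_nonneg\<close>). Splitting off powers of
  \<open>1 - x\<close>, one finds
  \<open>- P' = (1 - x)\<^bsup>q-1\<^esup> W\<close> and \<open>- P'' = (1 - x)\<^bsup>q-2\<^esup> S\<close>, where by the recurrence for \<open>V\<close>
  the coefficients of \<open>W\<close> and \<open>S\<close> are those of \<open>V\<close> times
  \<open>(p n + p c - a b) / (n + c)\<close> and \<open>T n / ((n + c) (n + c + 1))\<close>,
  with \<open>T\<close> a quadratic polynomial in \<open>n\<close>.

  \<^item> If \<open>a b / c \<le> p\<close> and \<open>q \<le> 1\<close>, all coefficients of \<open>W\<close> and of \<open>(1 - x)\<^bsup>q-1\<^esup>\<close> are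
    nonnegative, which is the sufficiency in (i).

  \<^item> The constant term of \<open>T\<close> is nonnegative exactly for \<open>p\<close> between the two roots \<open>p\<^sub>*\<close> and
    \<open>p\<^sup>*\<close> of a quadratic equation. If \<open>p \<ge> p\<^sup>*\<close>, all coefficients of \<open>T\<close> are nonpositive, and
    (iii) follows in the same way, since \<open>(1 - x)\<^bsup>q-2\<^esup>\<close> has nonnegative coefficients for \<open>q \<le> 2\<close>.

  \<^item> For (ii) with \<open>p\<^sub>* \<le> p < a b / c\<close> the sequence \<open>T\<close> may become negative, but only once and for
    good (\<open>T_sign_change\<close>). Since \<open>(1 - x)\<^bsup>q-2\<^esup>\<close> contains the factor \<open>1 / (1 - x)\<close>, it is enough
    that the partial sums of \<open>S\<close> are nonnegative, and by the sign pattern it is enough that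
    arbitrarily late ones are. These telescope twice, down to \<open>q \<Sum>V\<^sub>k - m V\<^sub>m\<close>, which is
    nonnegative for arbitrarily large \<open>m\<close> because \<open>q > 0\<close> (\<open>q_pos_p_pos\<close>) and \<open>V\<close> is summable
    (\<open>partial_sums_S_nonneg\<close>). For \<open>a b / c \<le> p\<close>, (ii) follows from (i).

  \<^item> Necessity of the lower bounds is the sign of the constant terms of \<open>P'\<close> and \<open>P''\<close>. For the upper
    bound, \<open>P\<close> is concave and positive on \<open>(0, 1)\<close> with \<open>P 0 = 1\<close>, so \<open>P x \<ge> 1 - x\<close>; as \<open>V\<close> is
    bounded this is impossible for \<open>q > 1\<close>, when \<open>P\<close> vanishes at 1 faster than \<open>1 - x\<close>
    (\<open>q_le_1_of_concave\<close>).
\<close>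

unbundle no vec_syntax and fps_syntax

section \<open>The power series of a real power of \<open>1 - x\<close>\<close>

text \<open>
  The power series of \<open>(1 - x)\<^bsup>-s\<^esup>\<close>. The exponent is negated so that nonnegative \<open>s\<close> gives nonnegative coefficients.
\<close>

definition neg_binomial :: "real \<Rightarrow> real fps" where
  "neg_binomial s = Abs_fps (\<lambda>n. pochhammer s n / fact n)"

lemma neg_binomial_nth [simp]: "neg_binomial s $ n = pochhammer s n / fact n"
  by (simp add: neg_binomial_def)

lemma neg_binomial_nth_nonneg: "s \<ge> 0 \<Longrightarrow> neg_binomial s $ n \<ge> 0"
  using pochhammer_pos[of s n] by (cases "s = 0") (auto simp: pochhammer_0_left)

text \<open>
  This is the Chu--Vandermonde identity, divided by \<open>n!\<close>.
\<close>

lemma neg_binomial_add: "neg_binomial (s + t) = neg_binomial s * neg_binomial t"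
proof (rule fps_ext)
  fix n
  have "neg_binomial (s + t) $ n
      = (\<Sum>k\<le>n. of_nat (n choose k) * pochhammer s k * pochhammer t (n - k) / fact n)"
    by (simp add: pochhammer_binomial_sum sum_divide_distrib)
  also have "\<dots> = (\<Sum>k\<le>n. pochhammer s k / fact k * (pochhammer t (n - k) / fact (n - k)))"
    by (rule sum.cong) (auto simp: binomial_fact)
  finally show "neg_binomial (s + t) $ n = (neg_binomial s * neg_binomial t) $ n"
    by (simp add: fps_mult_nth atLeast0AtMost)
qed

lemma neg_binomial_minus_1: "neg_binomial (-1) = 1 - fps_X"
proof (rule fps_ext)
  fix n
  consider "n = 0" | "n = 1" | m where "n = Suc (Suc m)"
    by (metis One_nat_def not0_implies_Suc)
  then show "neg_binomial (-1) $ n = (1 - fps_X) $ n"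
    by cases (simp_all add: fps_X_def pochhammer_rec)
qed

lemma neg_binomial_Suc: "neg_binomial s = (1 - fps_X) * neg_binomial (s + 1)"
  using neg_binomial_add[of "-1" "s + 1"] by (simp add: neg_binomial_minus_1)

lemma fps_deriv_neg_binomial:
  "fps_deriv (neg_binomial s) = fps_const s * neg_binomial (s + 1)"
  by (rule fps_ext) (auto simp: pochhammer_rec field_simps simp del: of_nat_Suc)

lemma neg_binomial_eval:
  fixes x :: real
  assumes "\<bar>x\<bar> < 1"
  shows "(\<lambda>n. neg_binomial s $ n * x ^ n) sums (1 - x) powr (-s)"
proof -
  have "(\<lambda>n. ((-s) gchoose n) * (-x) ^ n) sums (1 + (-x)) powr (-s)"
    by (rule gen_binomial_real) (use assms in auto)
  moreover have "((-s) gchoose n) * (-x) ^ n = neg_binomial s $ n * x ^ n" for n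
  proof -
    have "(-1 :: real) ^ n * (-1) ^ n = 1"
      by (simp flip: power_mult_distrib)
    then show ?thesis
      unfolding gbinomial_pochhammer power_minus[of x] neg_binomial_nth by simp
  qed
  ultimately show ?thesis
    by simp
qed

lemma eval_neg_binomial: "\<bar>x\<bar> < 1 \<Longrightarrow> eval_fps (neg_binomial s) x = (1 - x) powr (-s)"
  using neg_binomial_eval[of x s] by (simp add: eval_fps_def sums_iff)

lemma fps_conv_radius_neg_binomial: "fps_conv_radius (neg_binomial s) \<ge> 1"
  unfolding fps_conv_radius_def
  by (rule conv_radius_geI_ex') (use neg_binomial_eval in \<open>force simp: sums_iff\<close>)

text \<open>
  The factor through which differentiation acts when a power of \<open>1 - x\<close> is split off:
  it turns \<open>f\<close> into \<open>s f + (1 - x) f'\<close>.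
\<close>

definition binomial_twist :: "real \<Rightarrow> real fps \<Rightarrow> real fps" where
  "binomial_twist s f = fps_const s * f + (1 - fps_X) * fps_deriv f"

lemma fps_deriv_neg_binomial_mult:
  "fps_deriv (neg_binomial s * f) = neg_binomial (s + 1) * binomial_twist s f"
proof -
  define N where "N = neg_binomial (s + 1)"
  have "neg_binomial s = (1 - fps_X) * N"
    using neg_binomial_Suc[of s] by (simp add: N_def)
  then have "fps_deriv (neg_binomial s * f)
      = fps_const s * N * f + (1 - fps_X) * N * fps_deriv f"
    using fps_deriv_neg_binomial[of s] by (simp add: N_def)
  also have "\<dots> = N * binomial_twist s f"
    by (simp add: binomial_twist_def algebra_simps)
  finally show ?thesis
    by (simp only: N_def)
qed

lemma binomial_twist_nth:
  "binomial_twist s f $ n = (s - n) * f $ n + (n + 1) * f $ (n + 1)"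
  by (cases n) (auto simp: binomial_twist_def algebra_simps)

text \<open>
  The terms \<open>(k + 1) f\<^bsub>k+1\<^esub> - k f\<^bsub>k\<^esub>\<close> of the twist telescope, so its partial sums are
  as explicit as those of \<open>f\<close>.
\<close>

lemma sum_binomial_twist:
  "(\<Sum>k\<le>n. binomial_twist s f $ k) = s * (\<Sum>k\<le>n. f $ k) + (n + 1) * f $ (n + 1)"
  by (induction n) (simp_all add: binomial_twist_nth algebra_simps)

section \<open>Gauss's series and Euler's transformation\<close>

abbreviation gauss_fps :: "real \<Rightarrow> real \<Rightarrow> real \<Rightarrow> real fps" where
  "gauss_fps a b c \<equiv> fps_hypergeo [a, b] [c] 1"

lemma gauss_fps_rec:
  assumes "c > 0"
  shows "(n + 1) * (n + c) * gauss_fps a b c $ (n + 1) = (n + a) * (n + b) * gauss_fps a b c $ n"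
proof -
  have "gauss_fps a b c $ (n + 1)
      = (a + n) * (b + n) / ((n + 1) * (c + n)) * gauss_fps a b c $ n"
    using fps_hypergeo_rec[of "[a, b]" "[c]" 1 n] by (simp del: fps_hypergeo_nth add: add.commute)
  moreover have "real n + 1 \<noteq> 0" "n + c \<noteq> 0"
    using assms by linarith+
  ultimately show ?thesis
    by (simp del: fps_hypergeo_nth add: divide_simps add.commute mult_ac)
qed

lemma gauss_fps_pos: "a > 0 \<Longrightarrow> b > 0 \<Longrightarrow> c > 0 \<Longrightarrow> gauss_fps a b c $ n > 0"
  by (simp add: pochhammer_pos)

text \<open>
  Gauss's differential equation, \<open>x (1 - x) f'' + (c - (a + b + 1) x) f' - a b f = 0\<close>.
\<close>

definition gauss_op :: "real \<Rightarrow> real \<Rightarrow> real \<Rightarrow> real fps \<Rightarrow> real fps" where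
  "gauss_op a b c f =
     fps_X * (1 - fps_X) * fps_deriv (fps_deriv f)
     + (fps_const c - fps_const (a + b + 1) * fps_X) * fps_deriv f - fps_const (a * b) * f"

text \<open>
  The equation is first order as a recurrence for the coefficients: it couples only two
  neighbours.
\<close>

lemma gauss_op_nth:
  "gauss_op a b c f $ n = (n + 1) * (n + c) * f $ (n + 1) - (n + a) * (n + b) * f $ n"
proof -
  have expand: "gauss_op a b c f = fps_X * fps_deriv (fps_deriv f) - fps_X * (fps_X * fps_deriv (fps_deriv f))
     + fps_const c * fps_deriv f - fps_const (a + b + 1) * (fps_X * fps_deriv f) - fps_const (a * b) * f"
    by (simp add: gauss_op_def algebra_simps)
  consider "n = 0" | "n = 1" | m where "n = Suc (Suc m)"
    by (metis One_nat_def not0_implies_Suc)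
  then show ?thesis
    by cases (simp_all add: expand algebra_simps)
qed

lemma gauss_op_gauss_fps:
  assumes "c > 0"
  shows "gauss_op a b c (gauss_fps a b c) = 0"
  by (rule fps_ext) (use gauss_fps_rec[OF assms, of _ a b] in \<open>simp add: gauss_op_nth del: fps_hypergeo_nth\<close>)

lemma gauss_fps_unique:
  assumes "c > 0" "gauss_op a b c f = 0" "f $ 0 = 1"
  shows "f = gauss_fps a b c"
proof (rule fps_ext)
  fix n show "f $ n = gauss_fps a b c $ n"
  proof (induction n)
    case (Suc n)
    have "0 = (real n + 1) * (n + c) * f $ (n + 1) - (n + a) * (n + b) * f $ n"
      using gauss_op_nth[of a b c f n] by (simp add: assms(2) del: of_nat_Suc)
    then have "(real n + 1) * (n + c) * f $ (n + 1) = (real n + 1) * (n + c) * gauss_fps a b c $ (n + 1)"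
      unfolding gauss_fps_rec[OF assms(1)] Suc by simp
    moreover have "(real n + 1) * (n + c) \<noteq> 0"
      using assms(1) by (simp add: add_nonneg_eq_0_iff)
    ultimately have "f $ (n + 1) = gauss_fps a b c $ (n + 1)"
      by (metis mult_left_cancel)
    then show ?case
      by simp
  qed (use assms in simp)
qed

text \<open>
  Put \<open>h = a + b - c\<close> and \<open>y = 1 - x\<close>. The left-hand side is Gauss's operator with parameters
  \<open>a, b, c\<close> applied to \<open>(1 - x)\<^bsup>-h\<^esup> f\<close>, with the common factor \<open>(1 - x)\<^bsup>-h-2\<^esup>\<close> removed; \<open>f0\<close>, \<open>f1\<close>, \<open>f2\<close>
  stand for \<open>f\<close> and its first two derivatives. The right-hand side is the operator with
  parameters \<open>c - a, c - b, c\<close> applied to \<open>f\<close>. The choice of \<open>h\<close> is what makes the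
  coefficient of \<open>f0\<close> divisible by \<open>1 - x\<close> once more.
\<close>

lemma euler_op_identity:
  fixes X a b c f0 f1 f2 :: "'a :: comm_ring_1"
  assumes h: "h = a + b - c" and y: "y = 1 - X"
  shows "X * y * (h * (h + 1) * f0 + 2 * h * y * f1 + y * y * f2)
           + (c - (a + b + 1) * X) * (h * y * f0 + y * y * f1) - a * b * (y * y * f0)
         = y * y * (X * y * f2 + (c - (c - a + (c - b) + 1) * X) * f1 - (c - a) * (c - b) * f0)"
    (is "?l = ?r")
proof -
  have f0: "X * h * (h + 1) + (c - (a + b + 1) * X) * h - a * b * y
      = - (y * ((c - a) * (c - b)))"
    by (simp add: h y algebra_simps)
  have f1: "2 * h * X + (c - (a + b + 1) * X) = c - (c - a + (c - b) + 1) * X"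
    by (simp add: h algebra_simps)
  have "?l = y * (X * h * (h + 1) + (c - (a + b + 1) * X) * h - a * b * y) * f0
      + y * y * (2 * h * X + (c - (a + b + 1) * X)) * f1 + X * y * y * y * f2"
    by (simp add: ring_distribs mult_ac)
  also have "\<dots> = ?r"
    by (simp only: f0 f1) (simp add: ring_distribs mult_ac)
  finally show ?thesis .
qed

text \<open>
  Euler's transformation. The right-hand side solves Gauss's equation with parameters
  \<open>a, b, c\<close> by the preceding identity, and that equation has only one power series solution
  with constant term 1.
\<close>

lemma euler_transformation:
  assumes "c > 0"
  shows "gauss_fps a b c = neg_binomial (a + b - c) * gauss_fps (c - a) (c - b) c"
proof -
  define h where "h = a + b - c"
  define f where "f = gauss_fps (c - a) (c - b) c"
  define C where "C = neg_binomial (h + 2)"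
  define y :: "real fps" where "y = 1 - fps_X"
  have 1: "neg_binomial (h + 1) = y * C"
    using neg_binomial_Suc[of "h + 1"] by (simp add: C_def y_def add.assoc)
  have 0: "neg_binomial h = y * (y * C)"
    using neg_binomial_Suc[of h] 1 by (simp add: y_def)
  have d1: "fps_deriv (neg_binomial h * f)
      = C * (fps_const h * y * f + y * y * fps_deriv f)"
    unfolding fps_deriv_neg_binomial_mult 1 binomial_twist_def
    by (simp add: algebra_simps flip: y_def)
  have "fps_deriv (fps_deriv (neg_binomial h * f))
      = C * binomial_twist (h + 1) (binomial_twist h f)"
    unfolding fps_deriv_neg_binomial_mult C_def by (simp add: add.assoc)
  also have "binomial_twist (h + 1) (binomial_twist h f)
      = fps_const h * (fps_const h + 1) * f + 2 * fps_const h * y * fps_deriv f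
             + y * y * fps_deriv (fps_deriv f)"
    by (simp add: binomial_twist_def y_def algebra_simps flip: fps_const_add)
  finally have d2: "fps_deriv (fps_deriv (neg_binomial h * f))
      = C * (fps_const h * (fps_const h + 1) * f + 2 * fps_const h * y * fps_deriv f
             + y * y * fps_deriv (fps_deriv f))" .
  have cs: "fps_const h = fps_const a + fps_const b - fps_const c"
    by (simp add: h_def)
  have "gauss_op a b c (neg_binomial h * f) = C * (y * y * gauss_op (c - a) (c - b) c f)"
  proof -
    have factor: "X * y * (C * P) + K * (C * Q) - L * (y * (y * C) * f)
        = C * (X * y * P + K * Q - L * (y * y * f))" for X P K Q L :: "real fps"
      by (simp add: algebra_simps)
    show ?thesis
      unfolding gauss_op_def d2
      unfolding d1
      unfolding 0 y_def[symmetric] fps_const_add[symmetric]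
        fps_const_mult[symmetric] fps_const_sub[symmetric] fps_const_1_eq_1 factor
      by (rule arg_cong[where f = "(*) C"], rule euler_op_identity)
         (simp_all add: cs y_def)
  qed
  also have "\<dots> = 0"
    using gauss_op_gauss_fps[OF assms] by (simp add: f_def)
  finally have "neg_binomial h * f = gauss_fps a b c"
    by (intro gauss_fps_unique assms) (auto simp: f_def)
  then show ?thesis
    by (simp add: h_def f_def)
qed

text \<open>
  The differences \<open>z\<^bsub>n\<^esub> - z\<^bsub>n+1\<^esub>\<close> have bounded sums because \<open>z\<close> stays nonnegative.
\<close>

lemma telescoping_bound_imp_summable:
  fixes z v :: "nat \<Rightarrow> real"
  assumes v: "\<And>n. v n \<ge> 0" and z: "\<And>n. z n \<ge> 0" and "e > 0"
    and step: "\<And>n. n \<ge> N \<Longrightarrow> e * v n \<le> z n - z (Suc n)"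
  shows "summable v"
proof -
  have bound: "e * (\<Sum>n<k. v (n + N)) \<le> z N - z (k + N)" for k
  proof (induction k)
    case (Suc k)
    then show ?case
      using step[of "k + N"] by (simp add: algebra_simps)
  qed simp
  have "summable (\<lambda>n. v (n + N))"
  proof (rule bounded_imp_summable)
    fix k
    have "e * (\<Sum>n\<le>k. v (n + N)) \<le> z N"
      using bound[of "Suc k"] z[of "Suc k + N"] by (simp add: lessThan_Suc_atMost)
    then show "(\<Sum>n\<le>k. v (n + N)) \<le> z N / e"
      using \<open>e > 0\<close> by (simp add: field_simps)
  qed (use v in auto)
  then show ?thesis
    by (subst (asm) summable_iff_shift)
qed

text \<open>
  Convergence at \<open>x = 1\<close>. With \<open>v\<close> the coefficients and \<open>h = c - a - b\<close>, the recurrence gives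
  \<open>n v\<^bsub>n\<^esub> - (n + 1) v\<^bsub>n+1\<^esub> = v\<^bsub>n\<^esub> (h n - a b) / (n + c)\<close>. The fraction tends to \<open>h > 0\<close>, hence it exceeds
  \<open>h / 2\<close> from some index on, and a telescoping bound applies.
\<close>

lemma summable_gauss_fps:
  assumes "a > 0" "b > 0" "c > 0" "a + b < c"
  shows "summable (\<lambda>n. gauss_fps a b c $ n)"
proof (rule telescoping_bound_imp_summable)
  define h where "h = c - a - b"
  define N where "N = nat \<lceil>(2 * a * b + h * c) / h\<rceil>"
  show "h / 2 > 0"
    using assms by (simp add: h_def)
  fix n assume "n \<ge> N"
  then have "(2 * a * b + h * c) / h \<le> n"
    by (simp add: N_def nat_le_iff ceiling_le_iff)
  then have n: "h / 2 * (n + c) \<le> h * n - a * b"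
    using assms by (simp add: h_def field_simps)
  define v where "v = gauss_fps a b c $ n"
  have "v > 0"
    using gauss_fps_pos assms by (simp add: v_def)
  have "(n + c) * ((real n + 1) * gauss_fps a b c $ (n + 1)) = (n + a) * (n + b) * v"
    using gauss_fps_rec[OF assms(3), of n a b] by (simp only: v_def mult_ac)
  then have "(n + c) * (n * v - (real n + 1) * gauss_fps a b c $ (n + 1)) = (h * n - a * b) * v"
    by (simp only: right_diff_distrib) (simp add: h_def algebra_simps)
  also have "\<dots> \<ge> h / 2 * (n + c) * v"
    using n \<open>v > 0\<close> by (intro mult_right_mono) auto
  finally have "(n + c) * (h / 2 * v) \<le> (n + c) * (n * v - (real n + 1) * gauss_fps a b c $ (n + 1))"
    by (simp only: mult_ac)
  then have "h / 2 * v \<le> n * v - (real n + 1) * gauss_fps a b c $ (n + 1)"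
    by (rule mult_left_le_imp_le) (use assms in linarith)
  then show "h / 2 * gauss_fps a b c $ n
      \<le> n * gauss_fps a b c $ n - Suc n * gauss_fps a b c $ Suc n"
    by (simp add: v_def add.commute del: fps_hypergeo_nth)
qed (use gauss_fps_pos[OF assms(1-3)] in \<open>simp_all add: less_imp_le del: fps_hypergeo_nth\<close>)

section \<open>Absolute monotonicity in terms of power series coefficients\<close>

lemma funpow_fps_deriv_nth_0: "(fps_deriv ^^ k) f $ 0 = fact k * f $ k" for f :: "real fps"
proof -
  have "(fps_deriv ^^ k) f = fps_nth_deriv k f"
    by (induction k arbitrary: f) (simp_all add: funpow_Suc_right del: funpow.simps(2))
  then show ?thesis
    by (simp add: fps_deriv_maclauren_0)
qed

lemma funpow_fps_deriv_nonneg: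
  fixes f :: "real fps"
  assumes "\<And>n. f $ n \<ge> 0"
  shows "(fps_deriv ^^ k) f $ n \<ge> 0"
  by (induction k arbitrary: n) (simp_all add: assms)

lemma fps_conv_radius_funpow_deriv:
  fixes Q :: "real fps"
  shows "fps_conv_radius ((fps_deriv ^^ k) Q) \<ge> fps_conv_radius Q"
proof (induction k)
  case (Suc k)
  then show ?case
    using fps_conv_radius_deriv[of "(fps_deriv ^^ k) Q"] by (simp add: order_trans)
qed simp

lemma less_fps_conv_radius_funpow_deriv:
  fixes Q :: "real fps" and x :: real
  assumes "fps_conv_radius Q \<ge> 1" "\<bar>x\<bar> < 1"
  shows "ereal (norm x) < fps_conv_radius ((fps_deriv ^^ k) Q)"
proof -
  have "ereal (norm x) < 1"
    using assms(2) by simp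
  also have "1 \<le> fps_conv_radius Q"
    by (rule assms)
  also have "\<dots> \<le> fps_conv_radius ((fps_deriv ^^ k) Q)"
    by (rule fps_conv_radius_funpow_deriv)
  finally show ?thesis .
qed

lemma eval_neg_binomial_mult:
  assumes "fps_conv_radius f \<ge> 1" "\<bar>x\<bar> < 1"
  shows "eval_fps (neg_binomial s * f) x = (1 - x) powr (-s) * eval_fps f x"
proof -
  have "ereal (norm x) < fps_conv_radius g" if "fps_conv_radius g \<ge> 1" for g :: "real fps"
    using less_fps_conv_radius_funpow_deriv[OF that assms(2), of 0] by simp
  then show ?thesis
    using assms by (simp add: eval_fps_mult eval_neg_binomial fps_conv_radius_neg_binomial)
qed

text \<open>
  The function need not be a power series outside \<open>(0, 1)\<close>; openness of the interval is
  enough for its derivatives there to be those of the series.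
\<close>

lemma funpow_deriv_eval_fps:
  fixes Q :: "real fps"
  assumes radius: "fps_conv_radius Q \<ge> 1"
    and f: "\<And>x. x \<in> {0<..<1} \<Longrightarrow> f x = eval_fps Q x"
    and x: "x \<in> {0<..<1}"
  shows "(deriv ^^ k) f x = eval_fps ((fps_deriv ^^ k) Q) x"
    and "((deriv ^^ k) f has_real_derivative eval_fps ((fps_deriv ^^ Suc k) Q) x) (at x)"
proof -
  have der: "(eval_fps ((fps_deriv ^^ k) Q) has_real_derivative
      eval_fps ((fps_deriv ^^ Suc k) Q) x) (at x)" if "x \<in> {0<..<1}" for k x
  proof -
    have "ereal (norm x) < fps_conv_radius ((fps_deriv ^^ k) Q)"
      using that by (intro less_fps_conv_radius_funpow_deriv radius) simp
    then show ?thesis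
      using has_field_derivative_eval_fps[of x "(fps_deriv ^^ k) Q" UNIV] by simp
  qed
  have eq: "(deriv ^^ k) f x = eval_fps ((fps_deriv ^^ k) Q) x" if "x \<in> {0<..<1}" for k x
    using that
  proof (induction k arbitrary: x)
    case (Suc k)
    have "((deriv ^^ k) f has_real_derivative eval_fps ((fps_deriv ^^ Suc k) Q) x) (at x)"
      by (rule has_field_derivative_transform_within_open[OF der[OF Suc.prems], of "{0<..<1}"])
         (use Suc in auto)
    then show ?case
      by (simp add: DERIV_imp_deriv)
  qed (use f in simp)
  show "(deriv ^^ k) f x = eval_fps ((fps_deriv ^^ k) Q) x"
    by (rule eq[OF x])
  show "((deriv ^^ k) f has_real_derivative eval_fps ((fps_deriv ^^ Suc k) Q) x) (at x)"
    by (rule has_field_derivative_transform_within_open[OF der[OF x], of "{0<..<1}"])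
       (use eq x in auto)
qed

text \<open>
  Nonnegative coefficients clearly give nonnegative derivatives. Conversely the
  \<open>k\<close>-th derivative of the series is continuous at 0, where its value is \<open>k!\<close> times the \<open>k\<close>-th
  coefficient; so this coefficient is a limit of nonnegative numbers.
\<close>

lemma absolutely_monotonic_on_iff_fps_nonneg:
  assumes radius: "fps_conv_radius Q \<ge> 1"
    and f: "\<And>x. x \<in> {0<..<1} \<Longrightarrow> f x = eval_fps Q x"
  shows "absolutely_monotonic_on f {0<..<1} \<longleftrightarrow> (\<forall>n. Q $ n \<ge> 0)"
proof
  assume am: "absolutely_monotonic_on f {0<..<1}"
  show "\<forall>n. Q $ n \<ge> 0"
  proof
    fix k
    define R where "R = (fps_deriv ^^ k) Q"
    have "fps_conv_radius R \<ge> 1"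
      using radius fps_conv_radius_funpow_deriv[of Q k] order_trans unfolding R_def by blast
    then have "isCont (eval_fps R) 0"
      by (intro continuous_eval_fps) (auto intro: less_le_trans[of "ereal 0" 1])
    then have "(eval_fps R \<longlongrightarrow> eval_fps R 0) (at_right 0)"
      by (auto simp: isCont_def intro: filterlim_mono[OF _ order_refl at_le])
    moreover have "eventually (\<lambda>x. 0 \<le> eval_fps R x) (at_right 0)"
    proof -
      have "eventually (\<lambda>x::real. x \<in> {0<..<1}) (at_right 0)"
        by (rule eventually_at_right_real) simp
      then show ?thesis
      proof eventually_elim
        case (elim x)
        then have "0 \<le> (deriv ^^ k) f x"
          using am unfolding absolutely_monotonic_on_def by blast
        then show ?case
          using funpow_deriv_eval_fps(1)[OF radius f elim, of k] by (simp add: R_def)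
      qed
    qed
    ultimately have "0 \<le> eval_fps R 0"
      by (rule tendsto_lowerbound) simp
    then show "Q $ k \<ge> 0"
      by (simp add: eval_fps_at_0 R_def funpow_fps_deriv_nth_0 zero_le_mult_iff not_le)
         (meson fact_gt_zero not_le)
  qed
next
  assume nn: "\<forall>n. Q $ n \<ge> 0"
  show "absolutely_monotonic_on f {0<..<1}"
    unfolding absolutely_monotonic_on_def
  proof (intro allI ballI conjI)
    fix k and x :: real assume x: "x \<in> {0<..<1}"
    show "(deriv ^^ k) f differentiable at x"
      using funpow_deriv_eval_fps(2)[OF radius f x] real_differentiable_def by blast
    have "ereal (norm x) < fps_conv_radius ((fps_deriv ^^ k) Q)"
      using x by (intro less_fps_conv_radius_funpow_deriv radius) simp
    then have "0 \<le> eval_fps ((fps_deriv ^^ k) Q) x"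
      unfolding eval_fps_def
      using nn x by (intro suminf_nonneg summable_fps)
        (auto intro!: mult_nonneg_nonneg funpow_fps_deriv_nonneg)
    then show "0 \<le> (deriv ^^ k) f x"
      using funpow_deriv_eval_fps(1)[OF radius f x] by simp
  qed
qed

section \<open>Signs of coefficients and values of power series\<close>

lemma fps_mult_nonneg:
  fixes f g :: "real fps"
  assumes "\<And>n. f $ n \<ge> 0" "\<And>n. g $ n \<ge> 0"
  shows "(f * g) $ n \<ge> 0"
  unfolding fps_mult_nth by (intro sum_nonneg mult_nonneg_nonneg assms)

lemma fps_deriv_nonpos:
  fixes f :: "real fps"
  shows "(\<And>n. f $ n \<le> 0) \<Longrightarrow> fps_deriv f $ n \<le> 0"
  by (simp add: mult_le_0_iff)

text \<open>
  If the terms change sign at most once, from plus to minus, then the partial sums first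
  rise from 0 and then fall. So they can only be negative if they stay negative.
\<close>

lemma partial_sums_nonneg:
  fixes s :: "nat \<Rightarrow> real"
  assumes sign: "\<And>m n. s m < 0 \<Longrightarrow> m \<le> n \<Longrightarrow> s n \<le> 0"
    and inf: "\<And>N. \<exists>n\<ge>N. 0 \<le> (\<Sum>k\<le>n. s k)"
  shows "0 \<le> (\<Sum>k\<le>n. s k)"
proof (cases "\<exists>m\<le>n. s m < 0")
  case True
  then obtain m where m: "m \<le> n" "s m < 0"
    by blast
  obtain n' where n': "n' \<ge> n" "0 \<le> (\<Sum>k\<le>n'. s k)"
    using inf by blast
  have "(\<Sum>k\<le>n'. s k) = (\<Sum>k\<le>n. s k) + (\<Sum>k\<in>{n<..n'}. s k)"
    using n' by (subst sum.union_disjoint[symmetric]) (auto intro!: sum.cong)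
  moreover have "(\<Sum>k\<in>{n<..n'}. s k) \<le> 0"
    using m sign by (intro sum_nonpos) auto
  ultimately show ?thesis
    using n' by linarith
next
  case False
  then show ?thesis
    by (intro sum_nonneg) (auto simp: not_less)
qed

text \<open>
  Multiplication by \<open>1 / (1 - x)\<close> forms partial sums, and what remains of \<open>(1 - x)\<^bsup>-s\<^esup>\<close> has
  nonnegative coefficients. Thus \<open>f\<close> may have negative coefficients here.
\<close>

lemma neg_binomial_mult_nonneg:
  fixes f :: "real fps"
  assumes "s \<ge> 1" and partial: "\<And>n. 0 \<le> (\<Sum>k\<le>n. f $ k)"
  shows "(neg_binomial s * f) $ n \<ge> 0"
proof -
  have "(neg_binomial 1 * f) $ n = (\<Sum>k\<le>n. f $ k)" for n
    by (simp add: mult.commute[of "neg_binomial 1"] fps_mult_nth atLeast0AtMost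
        flip: pochhammer_fact)
  then have "(neg_binomial (s - 1) * (neg_binomial 1 * f)) $ n \<ge> 0"
    using assms by (intro fps_mult_nonneg[of "neg_binomial (s - 1)" "neg_binomial 1 * f"]
        neg_binomial_nth_nonneg) simp_all
  moreover have "neg_binomial s * f = neg_binomial (s - 1) * (neg_binomial 1 * f)"
    using neg_binomial_add[of "s - 1" 1] by (simp add: mult.assoc)
  ultimately show ?thesis
    by (simp only:)
qed

text \<open>
  Otherwise the series would dominate a multiple of the harmonic series.
\<close>

lemma summable_imp_index_times_term_small:
  fixes v :: "nat \<Rightarrow> real"
  assumes "summable v" "e > 0"
  shows "\<exists>n\<ge>N. n * v n \<le> e"
proof (rule ccontr)
  assume "\<not> ?thesis"
  then have big: "e < n * v n" if "n \<ge> N" for n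
    using that by (meson not_le)
  have "summable (\<lambda>n. e * inverse (real n))"
  proof (rule summable_comparison_test_ev)
    show "eventually (\<lambda>n. norm (e * inverse (real n)) \<le> v n) sequentially"
      using eventually_ge_at_top[of "max N 1"]
    proof eventually_elim
      case (elim n)
      then show ?case
        using big[of n] \<open>e > 0\<close> by (simp add: field_simps)
    qed
  qed (rule assms)
  then have "summable (\<lambda>n. inverse (real n))"
    using \<open>e > 0\<close> by (simp add: summable_cmult_iff)
  then show False
    using not_summable_harmonic[where 'a = real] summable_Suc_iff[of "\<lambda>n. inverse (real n)"]
    by (simp add: inverse_eq_divide)
qed

text \<open>
  Since all coefficients of degree at least 2 are nonpositive, \<open>(P x - 1) / x\<close> is
  nonincreasing in \<open>x\<close>. At \<open>y\<close> close to 1 it is at least \<open>- 1 / y\<close> because \<open>P y\<close> is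
  nonnegative, so at \<open>x\<close> it is at least \<open>- 1\<close>. In other words, a concave function with
  value 1 at 0 that is nonnegative on the interval lies above the chord from \<open>(0, 1)\<close> to \<open>(1, 0)\<close>.
\<close>

lemma eval_fps_ge_one_minus:
  fixes P :: "real fps"
  assumes radius: "fps_conv_radius P \<ge> 1" and P0: "P $ 0 = 1"
    and nonpos: "\<And>n. P $ Suc (Suc n) \<le> 0"
    and nonneg: "\<And>y. y \<in> {0<..<1} \<Longrightarrow> eval_fps P y \<ge> 0"
    and x: "x \<in> {0<..<1}"
  shows "eval_fps P x \<ge> 1 - x"
proof -
  have tail: "(\<lambda>n. P $ Suc n * y ^ Suc n) sums (eval_fps P y - 1)" if "y \<in> {0<..<1}" for y
  proof -
    have "ereal (norm y) < fps_conv_radius P"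
      using less_fps_conv_radius_funpow_deriv[OF radius, of y 0] that by simp
    from sums_eval_fps[OF this] show ?thesis
      by (subst sums_Suc_iff) (simp add: P0)
  qed
  have "y * (1 - eval_fps P x) \<le> x" if y: "0 < y" "y < 1" for y
  proof (cases "y \<le> x")
    case True
    then show ?thesis
      using mult_left_mono[of "1 - eval_fps P x" 1 y] nonneg[OF x] y by linarith
  next
    case False
    have "eval_fps P y - 1 \<le> y / x * (eval_fps P x - 1)"
    proof (rule sums_le)
      show "(\<lambda>n. P $ Suc n * y ^ Suc n) sums (eval_fps P y - 1)"
        using y by (intro tail) simp
      show "(\<lambda>n. y / x * (P $ Suc n * x ^ Suc n)) sums (y / x * (eval_fps P x - 1))"
        by (intro sums_mult tail x)
      show "P $ Suc n * y ^ Suc n \<le> y / x * (P $ Suc n * x ^ Suc n)" for n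
      proof (cases n)
        case 0
        then show ?thesis using x by simp
      next
        case (Suc m)
        have "x ^ n \<le> y ^ n"
          using False x by (intro power_mono) auto
        then have "P $ Suc n * (y * y ^ n) \<le> P $ Suc n * (y * x ^ n)"
          using nonpos[of m] y Suc by (intro mult_left_mono_neg mult_left_mono) auto
        then show ?thesis
          using x by (simp add: mult.left_commute)
      qed
    qed
    then have "y / x * (1 - eval_fps P x) \<le> 1 - eval_fps P y"
      by (simp add: algebra_simps)
    also have "\<dots> \<le> 1"
      using nonneg[of y] y by simp
    finally show ?thesis
      using x by (simp add: field_simps)
  qed
  then have "1 - eval_fps P x \<le> x"
    by (rule field_le_mult_one_interval)
  then show ?thesis
    by simp
qed

section \<open>The weighted hypergeometric function\<close>

locale gauss_weight =
  fixes a b c p :: real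
  assumes pos: "a > 0" "b > 0" "c > 0"
    and less: "a < c" "b < c" "c < a + b"
begin

text \<open>
  The second factor in Euler's transformation. Both of its upper parameters are positive,
  and it converges at \<open>x = 1\<close> because \<open>c - (c - a) - (c - b) = a + b - c > 0\<close>.
\<close>

definition V :: "real fps" where "V = gauss_fps (c - a) (c - b) c"

definition q :: real where "q = p - (a + b - c)"

text \<open>
  The power series of the weighted function, written with the exponent \<open>q\<close> that remains
  after Euler's transformation.
\<close>

definition P :: "real fps" where "P = neg_binomial (-q) * V"

lemma V_0 [simp]: "V $ 0 = 1"
  by (simp add: V_def)

lemma V_pos: "V $ n > 0"
  unfolding V_def by (rule gauss_fps_pos) (use pos less in auto)

lemma V_rec: "(real n + 1) * (n + c) * V $ (n + 1) = (n + c - a) * (n + c - b) * V $ n"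
  using gauss_fps_rec[OF pos(3), of n "c - a" "c - b"] by (simp only: V_def add_diff_eq)

lemma summable_V: "summable (\<lambda>n. V $ n)"
  unfolding V_def by (rule summable_gauss_fps) (use pos less in auto)

lemma radius_V: "fps_conv_radius V \<ge> 1"
  unfolding fps_conv_radius_def using conv_radius_geI[of "fps_nth V" "1::real"] summable_V
  by (simp add: one_ereal_def)

lemma radius_P: "fps_conv_radius P \<ge> 1"
  unfolding P_def using radius_V fps_conv_radius_neg_binomial[of "-q"]
    fps_conv_radius_mult[of "neg_binomial (-q)" V]
  by (meson min.boundedI order_trans)

lemma P_0 [simp]: "P $ 0 = 1"
  by (simp add: P_def)

lemma eval_P: "x \<in> {0<..<1} \<Longrightarrow> eval_fps P x = (1 - x) powr q * eval_fps V x"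
  unfolding P_def using eval_neg_binomial_mult[OF radius_V, of x "-q"] by simp

lemma weighted_2F1_eq_eval_P:
  assumes "x \<in> {0<..<1}"
  shows "weighted_2F1 a b c p x = eval_fps P x"
proof -
  have "hypergeo_2F1 a b c x = eval_fps (neg_binomial (a + b - c) * V) x"
    unfolding hypergeo_2F1_eq_eval_fps V_def by (subst euler_transformation[OF pos(3)]) rule
  also have "\<dots> = (1 - x) powr (- (a + b - c)) * eval_fps V x"
    using assms by (intro eval_neg_binomial_mult radius_V) simp
  finally have "weighted_2F1 a b c p x
      = ((1 - x) powr p * (1 - x) powr (- (a + b - c))) * eval_fps V x"
    unfolding weighted_2F1_def by (simp only: mult_ac)
  also have "(1 - x) powr p * (1 - x) powr (- (a + b - c)) = (1 - x) powr q"
    by (subst powr_add[symmetric]) (simp add: q_def algebra_simps)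
  finally show ?thesis
    using eval_P[OF assms] by simp
qed

section \<open>The first two derivatives\<close>

text \<open>
  \<open>W\<close> and \<open>S\<close> are what is left of \<open>- P'\<close> and \<open>- P''\<close> after the powers of \<open>1 - x\<close> with
  exponents \<open>q - 1\<close> and \<open>q - 2\<close> are split off.
\<close>

definition W :: "real fps" where "W = - binomial_twist (-q) V"

definition S :: "real fps" where "S = binomial_twist (1 - q) W"

lemma deriv_P: "fps_deriv P = - (neg_binomial (1 - q) * W)"
  unfolding P_def W_def fps_deriv_neg_binomial_mult by (simp add: algebra_simps)

lemma deriv2_P: "fps_deriv (fps_deriv P) = - (neg_binomial (2 - q) * S)"
  unfolding deriv_P S_def fps_deriv_neg fps_deriv_neg_binomial_mult by (simp add: algebra_simps)

lemma W_nth: "(n + c) * W $ n = (p * n + p * c - a * b) * V $ n"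
proof -
  have "(n + c) * W $ n = (q + n) * (n + c) * V $ n - (real n + 1) * (n + c) * V $ (n + 1)"
    by (simp add: W_def binomial_twist_nth algebra_simps)
  also have "\<dots> = ((q + n) * (n + c) - (n + c - a) * (n + c - b)) * V $ n"
    unfolding V_rec left_diff_distrib ..
  also have "(q + n) * (n + c) - (n + c - a) * (n + c - b) = p * n + p * c - a * b"
    by (simp add: q_def algebra_simps)
  finally show ?thesis .
qed

text \<open>
  The value at 0 of the quadratic \<open>T\<close> below. It is written so that the radicand in
  \<open>p_lower\<close> and \<open>p_upper\<close> is visible; these are its two zeros as a function of \<open>p\<close>.
\<close>

definition T0 :: real where
  "T0 = c * (c + 1) * (1/4 + a * b * (c - a) * (c - b) / (c\<^sup>2 * (c + 1))
     - (p - 1/2 - a * b / c)\<^sup>2)"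

text \<open>
  The numerator of the ratio of the coefficients of \<open>S\<close> and \<open>V\<close>. The cubic terms
  cancel.
\<close>

definition T :: "nat \<Rightarrow> real" where
  "T n = p * (1 - p) * n\<^sup>2 + p * (2 * c + 1 - p + 2 * (a * b - p * c)) * n + T0"

lemma T0_eq:
  "T0 = (1 - q) * (p * c - a * b) * (c + 1) + (c - a) * (c - b) * (p + p * c - a * b)"
proof -
  have "c \<noteq> 0" "c + 1 \<noteq> 0"
    using pos by linarith+
  then have K: "c\<^sup>2 * (c + 1) * (a * b * (c - a) * (c - b) / (c\<^sup>2 * (c + 1)))
      = a * b * (c - a) * (c - b)"
    by simp
  have sq: "c\<^sup>2 * (p - 1/2 - a * b / c)\<^sup>2 = (c * p - c / 2 - a * b)\<^sup>2"
    using \<open>c \<noteq> 0\<close> by (simp add: right_diff_distrib flip: power_mult_distrib)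
  have "c * T0 = c\<^sup>2 * (c + 1) / 4
      + c\<^sup>2 * (c + 1) * (a * b * (c - a) * (c - b) / (c\<^sup>2 * (c + 1)))
      - (c + 1) * (c\<^sup>2 * (p - 1/2 - a * b / c)\<^sup>2)"
    unfolding T0_def power2_eq_square[of c] by (simp only: ring_distribs mult_ac) simp
  also have "\<dots> = c\<^sup>2 * (c + 1) / 4 + a * b * (c - a) * (c - b)
      - (c + 1) * (c * p - c / 2 - a * b)\<^sup>2"
    unfolding K sq ..
  also have "\<dots> = c * ((1 - q) * (p * c - a * b) * (c + 1)
      + (c - a) * (c - b) * (p + p * c - a * b))"
    by (simp add: q_def power2_eq_square field_simps)
  finally show ?thesis
    using \<open>c \<noteq> 0\<close> mult_left_cancel by blast
qed

lemma T_eq: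
  "T n = (1 - q - n) * (p * n + p * c - a * b) * (n + c + 1)
       + (n + c - a) * (n + c - b) * (p * (real n + 1) + p * c - a * b)"
  unfolding T_def T0_eq q_def by (simp add: algebra_simps power2_eq_square)

lemma S_nth: "(n + c) * (n + c + 1) * S $ n = T n * V $ n"
proof -
  have "(n + c) * (n + c + 1) * S $ n = (1 - q - n) * (n + c + 1) * ((n + c) * W $ n)
      + (n + c) * (real n + 1) * ((real (n + 1) + c) * W $ (n + 1))"
    by (simp add: S_def binomial_twist_nth algebra_simps)
  also have "\<dots> = (1 - q - n) * (n + c + 1) * (p * n + p * c - a * b) * V $ n
      + (p * (real n + 1) + p * c - a * b) * ((real n + 1) * (n + c) * V $ (n + 1))"
    unfolding W_nth by (simp add: mult_ac)
  also have "\<dots> = T n * V $ n"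
    unfolding V_rec T_eq by (simp only: ring_distribs mult_ac)
  finally show ?thesis .
qed

lemma W_sign:
  "0 \<le> W $ n \<longleftrightarrow> 0 \<le> p * n + p * c - a * b" 
proof -
  have "n + c > 0" using pos by linarith
  then show ?thesis
    using W_nth[of n] V_pos[of n] by (metis zero_le_mult_iff less_imp_le not_le)
qed

lemma S_sign:
  "0 \<le> S $ n \<longleftrightarrow> 0 \<le> T n" "S $ n \<le> 0 \<longleftrightarrow> T n \<le> 0"
proof -
  have k: "(n + c) * (n + c + 1) > 0" using pos by (simp add: add_nonneg_pos)
  show "0 \<le> S $ n \<longleftrightarrow> 0 \<le> T n"
    using S_nth[of n] V_pos[of n] k by (metis zero_le_mult_iff less_imp_le not_le)
  show "S $ n \<le> 0 \<longleftrightarrow> T n \<le> 0"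
    using S_nth[of n] V_pos[of n] k by (metis mult_le_0_iff less_imp_le not_le)
qed

text \<open>
  If \<open>q > 1\<close>, the lower bound \<open>1 - x\<close> for \<open>P x = (1 - x)\<^bsup>q\<^esup> V x\<close> fails near 1, since \<open>V\<close> is bounded by
  its coefficient sum \<open>M\<close>.
\<close>

lemma q_le_1_of_concave:
  assumes "\<And>n. P $ Suc (Suc n) \<le> 0"
  shows "q \<le> 1"
proof (rule ccontr)
  assume "\<not> q \<le> 1"
  then have q: "q > 1" by simp
  define M where "M = (\<Sum>n. V $ n)"
  have V_nonneg: "V $ n \<ge> 0" for n
    using V_pos[of n] by simp
  have "M \<ge> 1"
    using sum_le_suminf[OF summable_V, of "{0}"] V_nonneg by (simp add: M_def)
  have V_le: "eval_fps V x \<le> M" and V_ge: "eval_fps V x \<ge> 0" if "x \<in> {0<..<1}" for x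
  proof -
    have "summable (\<lambda>n. V $ n * x ^ n)"
      using less_fps_conv_radius_funpow_deriv[OF radius_V, of x 0] that by (intro summable_fps) simp
    moreover have "V $ n * x ^ n \<le> V $ n" for n
      using that V_nonneg[of n] by (intro mult_left_le power_le_one) auto
    ultimately show "eval_fps V x \<le> M" "eval_fps V x \<ge> 0"
      unfolding eval_fps_def M_def using that
      by (auto intro!: suminf_le suminf_nonneg summable_V mult_nonneg_nonneg V_nonneg)
  qed
  \<comment> \<open>The distance from 1 at which \<open>P\<close> is at most half of what the lower bound requires.\<close>
  define y where "y = (1 / (2 * M)) powr (1 / (q - 1))"
  have y: "y \<in> {0<..<1}"
    using q \<open>M \<ge> 1\<close> powr_less_mono2[of "1 / (q - 1)" "1 / (2 * M)" 1] by (simp add: y_def)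
  have "y \<le> eval_fps P (1 - y)"
    using eval_fps_ge_one_minus[OF radius_P P_0 assms, of "1 - y"] y eval_P V_ge by simp
  also have "\<dots> \<le> y powr q * M"
    using eval_P[of "1 - y"] V_le[of "1 - y"] y by (auto intro!: mult_left_mono)
  also have "y powr q = y * y powr (q - 1)"
    using y by (simp add: powr_diff)
  also have "y powr (q - 1) = 1 / (2 * M)"
    using q \<open>M \<ge> 1\<close> by (simp add: y_def powr_powr)
  also have "y * (1 / (2 * M)) * M = y / 2"
    using \<open>M \<ge> 1\<close> by simp
  finally show False
    using y by simp
qed

section \<open>Parameters for which the derivatives have a sign\<close>

lemma deriv_P_nonpos:
  assumes "a * b / c \<le> p" "q \<le> 1"
  shows "fps_deriv P $ n \<le> 0"
proof -
  have "a * b \<le> p * c"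
    using assms pos by (simp add: field_simps)
  moreover have "p \<ge> 0"
    using assms(1) pos by (meson divide_nonneg_pos less_imp_le mult_nonneg_nonneg order_trans)
  ultimately have "0 \<le> W $ k" for k
    using mult_nonneg_nonneg[of p "real k"] W_sign[of k] by linarith
  then have "0 \<le> (neg_binomial (1 - q) * W) $ n"
    using assms(2) by (intro fps_mult_nonneg neg_binomial_nth_nonneg) auto
  then show ?thesis
    by (simp add: deriv_P del: fps_deriv_nth)
qed

text \<open>
  Put \<open>\<alpha> = a b / c\<close>, \<open>\<beta> = (c - a) (c - b) / c\<close> and \<open>t = \<alpha> - p\<close>; then \<open>p = \<alpha> - t\<close> and \<open>q = \<beta> - t\<close>.
  Nonnegativity of \<open>T0\<close> says that \<open>t (t + 1) (c + 1) \<le> \<alpha> \<beta>\<close>. As \<open>\<alpha>\<close> and \<open>\<beta>\<close> are both below \<open>c + 1\<close>,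
  \<open>t\<close> is below each of them.
\<close>

lemma q_pos_p_pos:
  assumes "p < a * b / c" "0 \<le> T0"
  shows "0 < q" "0 < p"
proof -
  define \<alpha> \<beta> t where "\<alpha> = a * b / c" and "\<beta> = (c - a) * (c - b) / c" and "t = a * b / c - p"
  have "t > 0"
    using assms by (simp add: t_def)
  have \<alpha>: "0 < \<alpha>" "\<alpha> < c + 1"
  proof -
    have "a * b < c * c" using pos less by (intro mult_strict_mono) auto
    then show "0 < \<alpha>" "\<alpha> < c + 1" using pos unfolding \<alpha>_def
      by (simp_all add: pos_divide_less_eq distrib_right)
  qed
  have \<beta>: "0 < \<beta>" "\<beta> < c + 1"
  proof -
    have "(c - a) * (c - b) < c * c" using pos less by (intro mult_strict_mono) auto
    then show "0 < \<beta>" "\<beta> < c + 1" using pos less unfolding \<beta>_def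
      by (simp_all add: pos_divide_less_eq distrib_right)
  qed
  have "T0 = c * (\<alpha> * \<beta> - t * (t + 1) * (c + 1))"
  proof -
    have "c \<noteq> 0" "c + 1 \<noteq> 0" using pos by linarith+
    have "c * (c + 1) * (a * b * (c - a) * (c - b) / (c\<^sup>2 * (c + 1))) = c * (\<alpha> * \<beta>)"
      using \<open>c \<noteq> 0\<close> \<open>c + 1 \<noteq> 0\<close> by (simp add: power2_eq_square \<alpha>_def \<beta>_def)
    moreover have "p - 1/2 - a * b / c = - (t + 1/2)"
      by (simp add: t_def)
    then have "1/4 - (p - 1/2 - a * b / c)\<^sup>2 = - t * (t + 1)"
      by (simp only:) (simp add: power2_eq_square algebra_simps)
    moreover have "X * (1/4 + K - s) = X * K + X * (1/4 - s)" for X K s :: real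
      by (simp add: algebra_simps)
    ultimately have "T0 = c * (\<alpha> * \<beta>) + c * (c + 1) * (- t * (t + 1))"
      unfolding T0_def by (simp only:)
    then show ?thesis
      by (simp add: algebra_simps)
  qed
  then have le: "t * (t + 1) * (c + 1) \<le> \<alpha> * \<beta>"
    using assms(2) pos by (simp add: zero_le_mult_iff)
  have "t * (c + 1) < t * (c + 1) * (t + 1)"
    using \<open>t > 0\<close> pos by simp
  then have lt: "t * (c + 1) < \<alpha> * \<beta>"
    using le by (simp add: mult_ac)
  have "\<alpha> * \<beta> \<le> (c + 1) * \<beta>" "\<alpha> * \<beta> \<le> \<alpha> * (c + 1)"
    using \<alpha> \<beta> by (auto intro: mult_right_mono mult_left_mono)
  then have "t * (c + 1) < \<beta> * (c + 1)" "t * (c + 1) < \<alpha> * (c + 1)"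
    using lt by (simp_all add: mult.commute)
  then have "t < \<beta>" "t < \<alpha>"
    using pos by (auto simp: mult_less_cancel_right)
  moreover have "q = \<beta> - t" "p = \<alpha> - t"
    using pos by (auto simp: q_def \<alpha>_def \<beta>_def t_def field_simps)
  ultimately show "0 < q" "0 < p"
    by simp_all
qed

text \<open>
  For \<open>p \<le> 1\<close> all coefficients of \<open>T\<close> are nonnegative. For \<open>p > 1\<close> the quadratic \<open>T\<close> is concave
  and starts with a nonnegative value, so it never recovers from a negative one.
\<close>

lemma T_sign_change:
  assumes "0 \<le> T0" "0 < p" "p < a * b / c" "T m < 0" "m \<le> n"
  shows "T n \<le> 0"
proof -
  define T1 where "T1 = p * (2 * c + 1 - p + 2 * (a * b - p * c))"
  have "p * c < a * b" "a * b < c * c"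
    using assms pos less by (auto simp: field_simps intro: mult_strict_mono)
  then have "p * c < c * c" by linarith
  then have "p < c" using pos by simp
  then have "T1 > 0"
    using \<open>p * c < a * b\<close> assms pos by (simp add: T1_def)
  have T: "T k = k * (p * (1 - p) * k + T1) + T0" for k
    by (simp add: T_def T1_def power2_eq_square algebra_simps)
  have "p * (1 - p) < 0"
  proof (rule ccontr)
    assume "\<not> ?thesis"
    then have "p \<le> 1"
      using assms(2) by (simp add: mult_less_0_iff)
    then have "0 \<le> T m"
      unfolding T using \<open>T1 > 0\<close> assms by (intro add_nonneg_nonneg mult_nonneg_nonneg) auto
    with assms show False by simp
  qed
  have "p * (1 - p) * m + T1 < 0"
  proof (rule ccontr)
    assume "\<not> ?thesis"
    then have "0 \<le> m * (p * (1 - p) * m + T1)"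
      by (intro mult_nonneg_nonneg) simp_all
    then show False
      using assms T[of m] by linarith
  qed
  moreover have "p * (1 - p) * n \<le> p * (1 - p) * m"
    using \<open>p * (1 - p) < 0\<close> assms by (intro mult_left_mono_neg) auto
  ultimately have "n * (p * (1 - p) * n + T1) \<le> n * (p * (1 - p) * m + T1)"
    and "n * (p * (1 - p) * m + T1) \<le> m * (p * (1 - p) * m + T1)"
    using \<open>m \<le> n\<close> by (auto intro: mult_left_mono mult_right_mono_neg)
  then show ?thesis
    using assms unfolding T by linarith
qed

text \<open>
  By the telescoping identity, a partial sum of \<open>S\<close> is \<open>1 - q\<close> times the one of \<open>W\<close>, plus a term
  that is nonnegative from some index \<open>M\<close> on. The partial sum of \<open>W\<close> is in turn \<open>q\<close> times the
  one of \<open>V\<close>, which is at least \<open>q\<close>, minus a term \<open>m V\<^sub>m\<close> that is at most \<open>q\<close> for arbitrarily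
  large \<open>m\<close>.
\<close>

lemma partial_sums_S_nonneg:
  assumes "p < a * b / c" "0 \<le> T0" "q \<le> 1"
  shows "0 \<le> (\<Sum>k\<le>n. S $ k)"
proof (rule partial_sums_nonneg)
  note qp = q_pos_p_pos[OF assms(1,2)]
  show "S $ n \<le> 0" if "S $ m < 0" "m \<le> n" for m n
    using that T_sign_change[OF assms(2) qp(2) assms(1)] S_sign by (metis not_le)
  fix N
  define M where "M = nat \<lceil>(a * b - p * c) / p\<rceil>"
  obtain m where m: "m \<ge> Suc (max N M)" "m * V $ m \<le> q"
    using summable_imp_index_times_term_small[OF summable_V qp(1)] by blast
  then obtain n where n: "m = Suc n" "n \<ge> N" "n \<ge> M"
    by (cases m) auto
  have "(a * b - p * c) / p \<le> n"
    using n(3) by (simp add: M_def nat_le_iff ceiling_le_iff)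
  then have "0 \<le> p * (n + 1) + p * c - a * b"
    using qp by (simp add: field_simps)
  then have W: "0 \<le> W $ (n + 1)"
    using W_sign[of "n + 1"] by simp
  have "(\<Sum>k\<le>n. W $ k) = q * (\<Sum>k\<le>n. V $ k) - m * V $ m"
    using sum_binomial_twist[of "-q" V n] by (simp add: W_def sum_negf n add.commute)
  moreover have "1 \<le> (\<Sum>k\<le>n. V $ k)"
    using member_le_sum[of 0 "{..n}" "\<lambda>k. V $ k"] less_imp_le[OF V_pos] by simp
  then have "q \<le> q * (\<Sum>k\<le>n. V $ k)"
    using qp by simp
  ultimately have "0 \<le> (\<Sum>k\<le>n. W $ k)"
    using m by simp
  then have "0 \<le> (\<Sum>k\<le>n. S $ k)"
    using sum_binomial_twist[of "1 - q" W n] W assms(3) by (simp add: S_def)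
  then show "\<exists>n\<ge>N. 0 \<le> (\<Sum>k\<le>n. S $ k)"
    using n by blast
qed

lemma deriv2_P_nonpos:
  assumes "p < a * b / c" "0 \<le> T0" "q \<le> 1"
  shows "fps_deriv (fps_deriv P) $ n \<le> 0"
proof -
  have "0 \<le> (neg_binomial (2 - q) * S) $ n"
    using assms(3) partial_sums_S_nonneg[OF assms] by (intro neg_binomial_mult_nonneg) auto
  then show ?thesis
    by (simp add: deriv2_P del: fps_deriv_nth)
qed

text \<open>
  When \<open>p\<close> exceeds \<open>a b / c\<close> by at least 1, the coefficients of \<open>n\<close> and \<open>n\<^sup>2\<close> in \<open>T\<close> are
  nonpositive as well.
\<close>

lemma deriv2_P_nonneg:
  assumes "T0 \<le> 0" "a * b / c + 1 \<le> p" "q \<le> 2"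
  shows "0 \<le> fps_deriv (fps_deriv P) $ n"
proof -
  have "p \<ge> 1"
    using assms(2) pos by (smt (verit) divide_pos_pos mult_pos_pos)
  have "a * b - p * c \<le> - c"
    using assms(2) pos by (simp add: field_simps)
  then have "2 * (a * b - p * c) \<le> - (2 * c)"
    by simp
  then have "2 * c + 1 - p + 2 * (a * b - p * c) \<le> 0"
    using \<open>p \<ge> 1\<close> by (smt (verit))
  then have "p * (2 * c + 1 - p + 2 * (a * b - p * c)) * k \<le> 0" for k :: nat
    using \<open>p \<ge> 1\<close> by (intro mult_nonpos_nonneg mult_nonneg_nonpos) simp_all
  moreover have "p * (1 - p) * k\<^sup>2 \<le> 0" for k :: nat
    using \<open>p \<ge> 1\<close> by (intro mult_nonpos_nonneg mult_nonneg_nonpos) simp_all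
  ultimately have "T k \<le> 0" for k
    unfolding T_def using assms(1) by (intro add_nonpos_nonpos)
  then have "0 \<le> (- S) $ k" for k
    using S_sign by simp
  then have "0 \<le> (neg_binomial (2 - q) * (- S)) $ n"
    using assms(3) by (intro fps_mult_nonneg neg_binomial_nth_nonneg) auto
  then show ?thesis
    by (simp add: deriv2_P del: fps_deriv_nth)
qed

lemma deriv_P_nth_0_nonpos_iff: "fps_deriv P $ 0 \<le> 0 \<longleftrightarrow> a * b / c \<le> p"
  using W_sign[of 0] pos by (simp add: deriv_P field_simps del: fps_deriv_nth)

lemma deriv2_P_nth_0_nonpos_iff: "fps_deriv (fps_deriv P) $ 0 \<le> 0 \<longleftrightarrow> 0 \<le> T0"
  using S_sign(1)[of 0] by (simp add: deriv2_P T_def del: fps_deriv_nth)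

text \<open>
  The radicand is at least \<open>1/4\<close>, because \<open>c\<close> exceeds \<open>a\<close> and \<open>b\<close>. So \<open>p_upper\<close> lies at least 1
  above \<open>a b / c\<close>, and every \<open>p < a b / c\<close> lies below the midpoint of the two roots.
\<close>

lemma T0_sign_cases:
  shows "0 \<le> T0 \<Longrightarrow> p_lower a b c \<le> p"
    and "p_lower a b c \<le> p \<Longrightarrow> p < a * b / c \<Longrightarrow> 0 \<le> T0"
    and "p_upper a b c \<le> p \<Longrightarrow> T0 \<le> 0"
    and "p_upper a b c \<le> p \<Longrightarrow> a * b / c + 1 \<le> p"
proof -
  define D where "D = 1/4 + a * b * (c - a) * (c - b) / (c\<^sup>2 * (c + 1))"
  have "D \<ge> 1/4"
    using pos less by (simp add: D_def)
  then have root: "sqrt D \<ge> 1/2" "0 \<le> D"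
    using real_le_rsqrt[of "1/2" D] by (auto simp: power2_eq_square)
  define x where "x = p - 1/2 - a * b / c"
  have pl: "p_lower a b c \<le> p \<longleftrightarrow> - sqrt D \<le> x" and pu: "p_upper a b c \<le> p \<longleftrightarrow> sqrt D \<le> x"
    by (auto simp: p_lower_def p_upper_def D_def x_def)
  have T0: "T0 = c * (c + 1) * (D - x\<^sup>2)"
    by (simp add: T0_def D_def x_def)
  have "0 \<le> k * y \<longleftrightarrow> 0 \<le> y" "k * y \<le> 0 \<longleftrightarrow> y \<le> 0" if "0 < k" for k y :: real
    using that by (auto simp: zero_le_mult_iff mult_le_0_iff)
  then have "0 \<le> T0 \<longleftrightarrow> x\<^sup>2 \<le> D" "T0 \<le> 0 \<longleftrightarrow> D \<le> x\<^sup>2"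
    using pos unfolding T0 by simp_all
  moreover have "x\<^sup>2 \<le> D \<longleftrightarrow> \<bar>x\<bar> \<le> sqrt D" "D \<le> x\<^sup>2 \<longleftrightarrow> sqrt D \<le> \<bar>x\<bar>"
    using real_sqrt_le_iff[of "x\<^sup>2" D] real_sqrt_le_iff[of D "x\<^sup>2"]
    by (simp_all only: real_sqrt_abs)
  ultimately have T0_iff: "0 \<le> T0 \<longleftrightarrow> \<bar>x\<bar> \<le> sqrt D" "T0 \<le> 0 \<longleftrightarrow> sqrt D \<le> \<bar>x\<bar>"
    by simp_all
  show "0 \<le> T0 \<Longrightarrow> p_lower a b c \<le> p"
    and "p_lower a b c \<le> p \<Longrightarrow> p < a * b / c \<Longrightarrow> 0 \<le> T0"
    and "p_upper a b c \<le> p \<Longrightarrow> T0 \<le> 0"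
    and "p_upper a b c \<le> p \<Longrightarrow> a * b / c + 1 \<le> p"
    using root(1) x_def unfolding pl pu T0_iff by linarith+
qed

lemma deriv_P_nonpos_iff: "(\<forall>n. fps_deriv P $ n \<le> 0) \<longleftrightarrow> a * b / c \<le> p \<and> q \<le> 1"
proof (intro iffI conjI)
  assume *: "\<forall>n. fps_deriv P $ n \<le> 0"
  show "a * b / c \<le> p"
    using * deriv_P_nth_0_nonpos_iff by blast
  show "q \<le> 1"
    using * by (intro q_le_1_of_concave) (auto simp: mult_le_0_iff dest!: spec[of _ "Suc _"])
qed (use deriv_P_nonpos in blast)

lemma deriv2_P_nonpos_iff: "(\<forall>n. fps_deriv (fps_deriv P) $ n \<le> 0) \<longleftrightarrow> p_lower a b c \<le> p \<and> q \<le> 1"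
proof (intro iffI conjI)
  assume *: "\<forall>n. fps_deriv (fps_deriv P) $ n \<le> 0"
  show "p_lower a b c \<le> p"
    using * deriv2_P_nth_0_nonpos_iff T0_sign_cases(1) by blast
  show "q \<le> 1"
    using * by (intro q_le_1_of_concave) (auto simp: mult_le_0_iff)
next
  assume *: "p_lower a b c \<le> p \<and> q \<le> 1"
  show "\<forall>n. fps_deriv (fps_deriv P) $ n \<le> 0"
  proof (cases "a * b / c \<le> p")
    case True
    then show ?thesis
      using * by (intro allI fps_deriv_nonpos deriv_P_nonpos) auto
  next
    case False
    then show ?thesis
      using * by (intro allI deriv2_P_nonpos T0_sign_cases(2)) auto
  qed
qed

end

section \<open>Absolute monotonicity of the weighted function\<close>

theorem theorem2:
  fixes a b c p :: real
  assumes "a > 0" and "b > 0" and "c > 0"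
    and "max a b < c" and "c < a + b"
  shows "(absolutely_monotonic_on (\<lambda>x. - deriv (weighted_2F1 a b c p) x) {0<..<1} \<longleftrightarrow>
            a * b / c \<le> p \<and> p \<le> a + b + 1 - c) \<and>
         (absolutely_monotonic_on (\<lambda>x. - (deriv ^^ 2) (weighted_2F1 a b c p) x) {0<..<1} \<longleftrightarrow>
            p_lower a b c \<le> p \<and> p \<le> a + b + 1 - c) \<and>
         (p_upper a b c \<le> p \<and> p \<le> a + b + 2 - c \<longrightarrow>
            absolutely_monotonic_on (\<lambda>x. (deriv ^^ 2) (weighted_2F1 a b c p) x) {0<..<1})"
proof -
  interpret gauss_weight a b c p
    by unfold_locales (use assms in auto)
  have deriv: "(deriv ^^ k) (weighted_2F1 a b c p) x = eval_fps ((fps_deriv ^^ k) P) x"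
    if "x \<in> {0<..<1}" for k x
    by (rule funpow_deriv_eval_fps(1)[OF radius_P weighted_2F1_eq_eval_P that])
  have radius: "fps_conv_radius ((fps_deriv ^^ k) P) \<ge> 1" for k
    using radius_P fps_conv_radius_funpow_deriv[of P k] by (rule order_trans)
  have neg: "- (deriv ^^ k) (weighted_2F1 a b c p) x = eval_fps (- ((fps_deriv ^^ k) P)) x"
    if "x \<in> {0<..<1}" for k x
    using less_fps_conv_radius_funpow_deriv[OF radius_P, of x k] that
    by (simp add: deriv eval_fps_minus)
  have "absolutely_monotonic_on (\<lambda>x. - (deriv ^^ k) (weighted_2F1 a b c p) x) {0<..<1}
      \<longleftrightarrow> (\<forall>n. (- ((fps_deriv ^^ k) P)) $ n \<ge> 0)" for k
    by (intro absolutely_monotonic_on_iff_fps_nonneg neg) (simp_all add: radius)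
  then have iff: "absolutely_monotonic_on (\<lambda>x. - (deriv ^^ k) (weighted_2F1 a b c p) x) {0<..<1}
      \<longleftrightarrow> (\<forall>n. (fps_deriv ^^ k) P $ n \<le> 0)" for k
    by (simp only: fps_neg_nth neg_0_le_iff_le)
  have "absolutely_monotonic_on (\<lambda>x. (deriv ^^ 2) (weighted_2F1 a b c p) x) {0<..<1}
      \<longleftrightarrow> (\<forall>n. (fps_deriv ^^ 2) P $ n \<ge> 0)"
    by (intro absolutely_monotonic_on_iff_fps_nonneg deriv radius)
  then have convex: "absolutely_monotonic_on (\<lambda>x. (deriv ^^ 2) (weighted_2F1 a b c p) x) {0<..<1}"
    if "p_upper a b c \<le> p" "p \<le> a + b + 2 - c"
    using deriv2_P_nonneg[OF T0_sign_cases(3)[OF that(1)] T0_sign_cases(4)[OF that(1)]] that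
    by (simp add: eval_nat_numeral q_def del: fps_deriv_nth)
  have q: "q \<le> 1 \<longleftrightarrow> p \<le> a + b + 1 - c"
    by (auto simp: q_def)
  show ?thesis
    using iff[of 1] iff[of 2] deriv_P_nonpos_iff deriv2_P_nonpos_iff convex
    unfolding q by (simp add: eval_nat_numeral del: fps_deriv_nth)
qed

end
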